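(* Let $n\ge 2$ and $N\ge 1$ be integers, let $\alpha_1,\dots,\alpha_N\in(0,\pi]$ be angles, and for $i,j=1,\dots,N$ and integers $k\ge 0$ let $f_{ij,k}$ be real numbers such that $f_{ij,k}=f_{ji,k}$ and $\sum_{k=0}^\infty |f_{ij,k}|<\infty$ for all $i,j$. Write $$f_{ij}(u)=\sum_{k=0}^\infty f_{ij,k}P_k^n(u).$$ Suppose that: (i) the matrix $\bigl(f_{ij,0}-w(\alpha_i)^{1/2}w(\alpha_j)^{1/2}\bigr)_{i,j=1}^N$ is positive semidefinite; (ii) the matrix $\bigl(f_{ij,k}\bigr)_{i,j=1}^N$ is positive semidefinite for every $k\ge 1$; (iii) $f_{ij}(u)\le 0$ whenever $-1\le u\le\cos(\alpha_i+\alpha_j)$, for all $i,j=1,\dots,N$. Then the density of every packing of spherical caps with angles $\alpha_1,\dots,\alpha_N$ on the unit sphere $S^{n-1}$ is at most $\max\{f_{ii}(1): i=1,\dots,N\}$.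
   Context: $S^{n-1}=\{x\in\mathbb{R}^n: x\cdot x=1\}$. The spherical cap with angle $\alpha\in[0,\pi]$ and center $x\in S^{n-1}$ is $C(x,\alpha)=\{y\in S^{n-1}: x\cdot y\ge\cos\alpha\}$. Its normalized volume is $$w(\alpha)=\frac{\omega_{n-1}(S^{n-2})}{\omega_n(S^{n-1})}\int_{\cos\alpha}^1(1-u^2)^{(n-3)/2}\,du,\qquad \omega_n(S^{n-1})=\frac{2\pi^{n/2}}{\Gamma(n/2)}.$$ $P_k^n$ denotes the Jacobi polynomial $P_k^{((n-3)/2,(n-3)/2)}$ of degree $k$, normalized so that $P_k^n(1)=1$. A packing of spherical caps with angles $\alpha_1,\dots,\alpha_N$ is a union of any number of spherical caps, each having one of the angles $\alpha_1,\dots,\alpha_N$, with pairwise disjoint topological interiors (relative to $S^{n-1}$); each angle may be used any number of times. The density of the packing is the sum of the normalized volumes of its constituent caps. *)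

theory Defs
  imports "HOL-Analysis.Analysis" "HOL-Computational_Algebra.Polynomial"
begin

definition sphere_area :: "nat \<Rightarrow> real" where
  "sphere_area n = 2 * pi powr (real n / 2) / Gamma (real n / 2)"

definition cap :: "real ^ 'n \<Rightarrow> real \<Rightarrow> (real ^ 'n) set" where
  "cap x \<alpha> = {y \<in> sphere 0 1. x \<bullet> y \<ge> cos \<alpha>}"

text \<open>Normalized volume of a cap with angle \<open>\<alpha>\<close> on the unit sphere of \<open>n\<close>-dimensional space.
  For \<open>n = 2\<close> the integrand is unbounded at \<open>\<plusminus>1\<close>, but still (absolutely) integrable.\<close>

definition cap_volume :: "nat \<Rightarrow> real \<Rightarrow> real" where
  "cap_volume n \<alpha> = sphere_area (n - 1) / sphere_area n *
     integral {cos \<alpha>..1} (\<lambda>u. (1 - u\<^sup>2) powr ((real n - 3) / 2))"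

text \<open>The Jacobi polynomial with parameters \<open>a\<close>, \<open>b\<close> in its usual normalization (value
  \<open>(k + a) gchoose k\<close> at \<open>1\<close>), by Szego's explicit formula, which results from expanding
  the Rodrigues formula with the Leibniz rule.\<close>

definition jacobi_poly :: "real \<Rightarrow> real \<Rightarrow> nat \<Rightarrow> real poly" where
  "jacobi_poly a b k = (\<Sum>s\<le>k. smult (((real k + a) gchoose (k - s)) * ((real k + b) gchoose s))
     ([:-1/2, 1/2:] ^ s * [:1/2, 1/2:] ^ (k - s)))"

definition normalized_jacobi :: "nat \<Rightarrow> nat \<Rightarrow> real poly" where
  "normalized_jacobi n k =
     (let p = jacobi_poly ((real n - 3) / 2) ((real n - 3) / 2) k in smult (1 / poly p 1) p)"

lemma poly_jacobi_poly_1: "poly (jacobi_poly a b k) 1 = (real k + a) gchoose k"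
proof -
  have "poly (jacobi_poly a b k) 1 =
      (\<Sum>s\<le>k. ((real k + a) gchoose (k - s)) * ((real k + b) gchoose s) * (0 ^ s))"
    unfolding jacobi_poly_def poly_sum by (intro sum.cong) (auto simp: poly_power)
  also have "\<dots> = (\<Sum>s\<in>{0}. ((real k + a) gchoose (k - s)) * ((real k + b) gchoose s) * (0 ^ s))"
    by (intro sum.mono_neutral_right) auto
  finally show ?thesis by simp
qed

lemma poly_normalized_jacobi_1:
  assumes "n \<ge> 2"
  shows "poly (normalized_jacobi n k) 1 = 1"
proof -
  have "(real k + (real n - 3) / 2) gchoose k > 0"
    unfolding gbinomial_prod_rev using assms
  proof (intro divide_pos_pos prod_pos)
    fix i assume "i \<in> {0..<k}"
    then have "real i + 1 \<le> real k"
      by simp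
    with assms show "real k + (real n - 3) / 2 - real i > 0"
      by (simp add: field_simps)
  qed simp
  then show ?thesis
    by (simp add: normalized_jacobi_def Let_def poly_jacobi_poly_1)
qed

text \<open>Matrices with rows and columns indexed by \<open>1, \<dots>, N\<close>.\<close>

definition pos_semidef :: "nat \<Rightarrow> (nat \<Rightarrow> nat \<Rightarrow> real) \<Rightarrow> bool" where
  "pos_semidef N M \<longleftrightarrow>
     (\<forall>i\<in>{1..N}. \<forall>j\<in>{1..N}. M i j = M j i) \<and>
     (\<forall>c. (\<Sum>i=1..N. \<Sum>j=1..N. c i * M i j * c j) \<ge> 0)"

text \<open>A packing with angles from \<open>A\<close> is given by the set of pairs (center, angle) of its caps.
  Since caps of positive angle have nonempty interior, no cap can occur twice in a packing,
  so a set suffices. The set is not assumed finite; the density is therefore an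
  unconditional sum of nonnegative terms in the extended reals, which always exists.\<close>

definition cap_packing :: "real set \<Rightarrow> ((real ^ 'n) \<times> real) set \<Rightarrow> bool" where
  "cap_packing A P \<longleftrightarrow> P \<subseteq> sphere 0 1 \<times> A \<and>
     pairwise (\<lambda>(x, a) (y, b).
       disjnt (top_of_set (sphere 0 1) interior_of cap x a)
              (top_of_set (sphere 0 1) interior_of cap y b)) P"

definition packing_density :: "((real ^ 'n) \<times> real) set \<Rightarrow> ereal" where
  "packing_density P = (\<Sum>\<^sub>\<infinity>(x, a)\<in>P. ereal (cap_volume CARD('n) a))"

end

theory Submission
  imports Defs
begin

text \<open>
  For centers \<open>x\<^sub>k\<close> of angle \<open>\<alpha>\<^bsub>i(k)\<^esub>\<close> and volume \<open>w\<^sub>k\<close> in a finite subpacking, the linear programming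
  argument estimates \<open>\<Sum>\<^sub>k\<^sub>,\<^sub>l (w\<^sub>k w\<^sub>l)\<^bsup>1/2\<^esup> f\<^bsub>i(k)i(l)\<^esub>(x\<^sub>k \<bullet> x\<^sub>l)\<close> in two ways. Distinct caps have
  \<open>x\<^sub>k \<bullet> x\<^sub>l \<le> cos (\<alpha>\<^bsub>i(k)\<^esub> + \<alpha>\<^bsub>i(l)\<^esub>)\<close>, so (iii) leaves only the diagonal, at most the density times
  the maximum. Expanding in \<open>P\<^sub>m\<close>, (i) and (ii) show that the sum is at least the square of the density,
  because the kernels \<open>P\<^sub>m(x \<bullet> y)\<close> are positive definite on the sphere.

  Positive definiteness is proved without integration on the sphere: a multiple of \<open>P\<^sub>m(x \<bullet> y)\<close> is
  written as \<open>\<Sum>\<^sub>l \<phi>\<^sub>l(x) \<phi>\<^sub>l(y)\<close> with polynomial functions \<open>\<phi>\<^sub>l\<close>, by induction on \<open>m\<close>. The step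
  replaces \<open>\<phi>\<close> by the harmonic projections of \<open>x\<^sub>i \<phi>\<close>, which on the sphere are multiples of
  \<open>(m + n - 2) x\<^sub>i \<phi> - D\<^sub>i \<phi>\<close> with \<open>D\<^sub>i\<close> the tangential part of the \<open>i\<close>-th partial derivative. The new
  kernel only involves \<open>P\<^sub>m\<close> and its first two derivatives, and the differential equation of \<open>P\<^sub>m\<close> and
  the recursion \<open>(m + n - 2) P\<^bsub>m+1\<^esub> = (m + n - 2) u P\<^sub>m - (1 - u\<^sup>2) P\<^sub>m'\<close> identify it as a multiple of
  \<open>P\<^bsub>m+1\<^esub>\<close>.
\<close>

subsection \<open>Recursion and differential equation of the Jacobi polynomials\<close>

lemma pderiv_sum: "pderiv (sum f A) = (\<Sum>x\<in>A. pderiv (f x))"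
  using higher_pderiv_sum[of 1 f A] by simp

text \<open>With X = (u - 1) / 2 and Y = (u + 1) / 2 one has u = X + Y and 1 - u^2 = -4XY. So
  multiplication by u and (1 - u^2) d/du both turn forms of degree m in X, Y into forms of degree m
  + 1, and it suffices to compare coefficients.\<close>

lemma jacobi_poly_Suc:
  fixes a :: real
  shows "smult ((real m + 1) * (real m + 2 * a + 1)) (jacobi_poly a a (Suc m)) =
    smult (real m + 1 + a) (smult (real m + 2 * a + 1) ([:0, 1:] * jacobi_poly a a m)
      - [:1, 0, -1:] * pderiv (jacobi_poly a a m))"
proof (rule poly_ext)
  fix u :: real
  define X Y \<mu> where "X = (u - 1) / 2" and "Y = (u + 1) / 2" and "\<mu> = real m + 2 * a + 1"
  have u: "u = X + Y" "1 - u\<^sup>2 = - (4 * X * Y)"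
    by (simp_all add: X_def Y_def field_simps power2_eq_square)
  define A where "A = (\<lambda>k s. ((real k + a) gchoose (k - s)) * ((real k + a) gchoose s))"
  define T where "T = (\<lambda>s. X ^ s * Y ^ (Suc m - s))"
  have XY: "poly [:-1/2, 1/2:] u = X" "poly [:1/2, 1/2:] u = Y"
    by (simp_all add: X_def Y_def field_simps)
  have J: "poly (jacobi_poly a a k) u = (\<Sum>s\<le>k. A k s * (X ^ s * Y ^ (k - s)))" for k
    unfolding jacobi_poly_def poly_sum poly_smult poly_mult poly_power XY A_def by simp
  have J': "poly (pderiv (jacobi_poly a a m)) u =
      (\<Sum>s\<le>m. A m s * ((real s * X ^ (s - 1) * Y ^ (m - s) + real (m - s) * X ^ s * Y ^ (m - s - 1)) / 2))"
    unfolding jacobi_poly_def pderiv_sum pderiv_smult pderiv_mult pderiv_power poly_sum poly_smult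
      poly_mult poly_power poly_add XY A_def
    by (intro sum.cong) (auto simp: pderiv_pCons XY field_simps)
  have D: "4 * X * Y * (A m s * ((real s * X ^ (s - 1) * Y ^ (m - s) + real (m - s) * X ^ s * Y ^ (m - s - 1)) / 2))
      = A m s * (2 * real s * T s + 2 * real (m - s) * T (Suc s))" if "s \<le> m" for s
  proof -
    have *: "real s * (X * X ^ (s - 1)) = real s * X ^ s"
      "real (m - s) * (Y * Y ^ (m - s - 1)) = real (m - s) * Y ^ (m - s)"
      by (cases s; cases "m - s"; simp)+
    have T: "T s = Y * (X ^ s * Y ^ (m - s))" "T (Suc s) = X * (X ^ s * Y ^ (m - s))"
      using that by (simp_all add: T_def Suc_diff_le)
    have "4 * X * Y * (A m s * ((real s * X ^ (s - 1) * Y ^ (m - s) +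
        real (m - s) * X ^ s * Y ^ (m - s - 1)) / 2)) =
      2 * A m s * (Y * Y ^ (m - s) * (real s * (X * X ^ (s - 1))) +
        X * X ^ s * (real (m - s) * (Y * Y ^ (m - s - 1))))"
      by (simp add: field_simps)
    then show ?thesis
      unfolding * T by (simp add: algebra_simps)
  qed
  have U: "\<mu> * (X + Y) * (A m s * (X ^ s * Y ^ (m - s))) = A m s * (\<mu> * T s + \<mu> * T (Suc s))" 
    if "s \<le> m" for s
    using that by (simp add: T_def Suc_diff_le algebra_simps)
  \<comment> \<open>The coefficient of \<open>T s\<close> collects contributions of two summands of
    the degree m polynomial, those with index s and s - 1. At s = 0 and s = m + 1 only one of them
    exists.\<close>
  have coeff: "(real m + 1) * \<mu> * A (Suc m) s = (real m + 1 + a) *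
      ((if s \<le> m then A m s * (\<mu> + 2 * real s) else 0) +
       (if s \<noteq> 0 then A m (s - 1) * (\<mu> + 2 * real (Suc m - s)) else 0))" if "s \<le> Suc m" for s
  proof -
    define x where "x = real m + a"
    have gb_Suc: "real (Suc k) * (x gchoose Suc k) = (x - real k) * (x gchoose k)" for k
      using gbinomial_mult_1[of x k] by (simp add: algebra_simps)
    have x1: "real (Suc m) + a = x + 1"
      by (simp add: x_def)
    consider "s = 0" | t r where "s = Suc t" "m = Suc (r + t)" | "s = Suc m"
    proof (cases s)
      case (Suc t)
      then show ?thesis
        using that(1,3) that(2)[of t "m - Suc t"] \<open>s \<le> Suc m\<close> by (cases "t = m") auto
    qed
    then show ?thesis
    proof cases
      case 2
      \<comment> \<open>All four binomial coefficients with upper entry x become polynomial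
        multiples of p and q, so the identity becomes one without division.\<close>
      define p q where "p = (x gchoose r) / real (Suc r)" and "q = (x gchoose t) / real (Suc t)"
      have r: "x gchoose r = real (Suc r) * p" and t: "x gchoose t = real (Suc t) * q"
        by (simp_all add: p_def q_def)
      have Sr: "x gchoose Suc r = (x - real r) * p" and St: "x gchoose Suc t = (x - real t) * q"
        using gb_Suc[of r] gb_Suc[of t] by (simp_all add: p_def q_def field_simps del: of_nat_Suc)
      have "Suc m - s = Suc r" "m - s = r" "m - (s - 1) = Suc r" "s - 1 = t"
        using 2 by auto
      then show ?thesis
        unfolding A_def x1 2(1) gbinomial_Suc_Suc unfolding x_def[symmetric]
        using 2 by (simp add: r t Sr St gbinomial_Suc_Suc) (simp add: x_def \<mu>_def algebra_simps)
    qed (use Suc_times_gbinomial[of m x] in \<open>simp_all add: A_def x1 flip: x_def, simp_all add: x_def algebra_simps\<close>)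
  qed
  have "(real m + 1) * \<mu> * poly (jacobi_poly a a (Suc m)) u =
      (\<Sum>s\<le>Suc m. (real m + 1) * \<mu> * A (Suc m) s * T s)"
    unfolding J T_def sum_distrib_left by (simp only: mult.assoc)
  also have "\<dots> =
     (real m + 1 + a) * ((\<Sum>s\<le>Suc m. (if s \<le> m then A m s * (\<mu> + 2 * real s) else 0) * T s) +
       (\<Sum>s\<le>Suc m. (if s \<noteq> 0 then A m (s - 1) * (\<mu> + 2 * real (Suc m - s)) else 0) * T s))"
    unfolding sum.distrib[symmetric] sum_distrib_left 
    by (intro sum.cong refl, subst coeff) (simp_all only: atMost_iff distrib_left distrib_right mult.assoc)
  also have "(\<Sum>s\<le>Suc m. (if s \<le> m then A m s * (\<mu> + 2 * real s) else 0) * T s) =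
      (\<Sum>s\<le>m. A m s * (\<mu> + 2 * real s) * T s)"
    by simp
  also have "(\<Sum>s\<le>Suc m. (if s \<noteq> 0 then A m (s - 1) * (\<mu> + 2 * real (Suc m - s)) else 0) * T s) =
      (\<Sum>s\<le>m. A m s * (\<mu> + 2 * real (m - s)) * T (Suc s))"
    by (subst sum.atMost_Suc_shift) simp
  also have "(\<Sum>s\<le>m. A m s * (\<mu> + 2 * real s) * T s) +
       (\<Sum>s\<le>m. A m s * (\<mu> + 2 * real (m - s)) * T (Suc s)) =
      (\<Sum>s\<le>m. A m s * (\<mu> * T s + \<mu> * T (Suc s))) + 
      (\<Sum>s\<le>m. A m s * (2 * real s * T s + 2 * real (m - s) * T (Suc s)))"
    unfolding sum.distrib[symmetric] by (intro sum.cong) (auto simp: algebra_simps)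
  also have "(\<Sum>s\<le>m. A m s * (\<mu> * T s + \<mu> * T (Suc s))) = \<mu> * u * poly (jacobi_poly a a m) u"
    unfolding J sum_distrib_left by (intro sum.cong) (auto simp: U u(1))
  also have "(\<Sum>s\<le>m. A m s * (2 * real s * T s + 2 * real (m - s) * T (Suc s))) =
      - (1 - u\<^sup>2) * poly (pderiv (jacobi_poly a a m)) u"
    unfolding J' u(2) sum_distrib_left minus_minus by (intro sum.cong) (auto simp only: D atMost_iff)
  finally show "poly (smult ((real m + 1) * (real m + 2 * a + 1)) (jacobi_poly a a (Suc m))) u =
     poly (smult (real m + 1 + a) (smult (real m + 2 * a + 1) ([:0, 1:] * jacobi_poly a a m)
      - [:1, 0, -1:] * pderiv (jacobi_poly a a m))) u"
    by (simp add: \<mu>_def algebra_simps power2_eq_square)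
qed

lemma jacobi_poly_diag_1_pos:
  assumes "n \<ge> 2"
  shows "poly (jacobi_poly ((real n - 3) / 2) ((real n - 3) / 2) k) 1 > 0"
  unfolding poly_jacobi_poly_1 gbinomial_prod_rev
proof (intro divide_pos_pos prod_pos)
  fix i assume "i \<in> {0..<k}"
  then have "real i + 1 \<le> real k"
    by simp
  with assms show "real k + (real n - 3) / 2 - real i > 0"
    by (simp add: field_simps)
qed simp

lemma normalized_jacobi_0: "normalized_jacobi n 0 = 1"
  by (simp add: normalized_jacobi_def jacobi_poly_def one_pCons)

lemma normalized_jacobi_1:
  assumes "n \<ge> 2"
  shows "normalized_jacobi n (Suc 0) = [:0, 1:]"
  using assms by (simp add: normalized_jacobi_def jacobi_poly_def field_simps)

text \<open>The values \<open>g\<close> at 1 satisfy \<open>g_Suc\<close>, whose factors are exactly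
  those by which \<open>jacobi_poly_Suc\<close> differs from this recursion. The factor m + n - 2
  stays on the left because it vanishes for n = 2 and m = 0; the degree 1 polynomial is therefore
  computed separately.\<close>

lemma normalized_jacobi_Suc:
  assumes "n \<ge> 2"
  shows "smult (real m + real n - 2) (normalized_jacobi n (Suc m)) =
    smult (real m + real n - 2) ([:0, 1:] * normalized_jacobi n m)
      - [:1, 0, -1:] * pderiv (normalized_jacobi n m)" (is "_ = ?R")
proof -
  define a where "a = (real n - 3) / 2"
  define g where "g = (\<lambda>k. poly (jacobi_poly a a k) 1)"
  have g: "g k > 0" for k
    using jacobi_poly_diag_1_pos[OF assms] by (simp add: g_def a_def)
  have J: "jacobi_poly a a k = smult (g k) (normalized_jacobi n k)" for k
    using g[of k] by (simp add: normalized_jacobi_def Let_def g_def flip: a_def)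
  have g_Suc: "(real m + 1) * g (Suc m) = (real m + 1 + a) * g m"
    using Suc_times_gbinomial[of m "real m + a"] by (simp add: g_def poly_jacobi_poly_1 algebra_simps)
  have "smult ((real m + 1) * g (Suc m)) (smult (real m + real n - 2) (normalized_jacobi n (Suc m))) =
      smult ((real m + 1) * (real m + real n - 2) * g (Suc m)) (normalized_jacobi n (Suc m))"
    by (simp add: mult_ac)
  also have "\<dots> =
      smult ((real m + 1 + a) * g m) ?R"
  proof -
    have "real m + 2 * a + 1 = real m + real n - 2"
      by (simp add: a_def field_simps)
    moreover have "smult (real m + real n - 2) ([:0, 1:] * smult (g m) (normalized_jacobi n m))
        - [:1, 0, -1:] * pderiv (smult (g m) (normalized_jacobi n m)) = smult (g m) ?R"
      by (simp only: pderiv_smult mult_smult_right smult_diff_right smult_smult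
          mult.commute[of "real m + real n - 2" "g m"])
    ultimately show ?thesis
      using jacobi_poly_Suc[of m a] unfolding J by (simp only: smult_smult)
  qed
  finally have "smult ((real m + 1) * g (Suc m)) (smult (real m + real n - 2) (normalized_jacobi n (Suc m))) =
      smult ((real m + 1) * g (Suc m)) ?R"
    by (simp only: g_Suc)
  moreover have "p = q" if "smult c p = smult c q" "c \<noteq> 0" for c and p q :: "real poly"
    using that by (auto simp: poly_eq_iff)
  moreover have "(real m + 1) * g (Suc m) \<noteq> 0"
    using g[of "Suc m"] by simp
  ultimately show ?thesis
    by blast
qed

text \<open>Induction along the recursion, starting at 1 so that the factor \<mu> is positive. The
  derivatives of the next polynomial r are expressed through p and p', and the equation for p closes
  the computation.\<close>

lemma normalized_jacobi_ode:
  assumes n: "n \<ge> 2" and m: "m \<ge> 1"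
  shows "(1 - u\<^sup>2) * poly (pderiv (pderiv (normalized_jacobi n m))) u =
    (real n - 1) * u * poly (pderiv (normalized_jacobi n m)) u
      - real m * (real m + real n - 2) * poly (normalized_jacobi n m) u"
  using m
proof (induction m arbitrary: u rule: dec_induct)
  case base
  show ?case
    by (simp add: normalized_jacobi_1[OF n] pderiv_pCons)
next
  case (step m)
  define \<mu> p r where "\<mu> = real m + real n - 2" and "p = normalized_jacobi n m"
    and "r = normalized_jacobi n (Suc m)"
  have \<mu>: "\<mu> > 0"
    using n step.hyps by (simp add: \<mu>_def)
  have IH: "(1 - u\<^sup>2) * poly (pderiv (pderiv p)) u =
      (real n - 1) * u * poly (pderiv p) u - real m * \<mu> * poly p u" for u
    using step.IH by (simp add: p_def \<mu>_def)
  have rec: "smult \<mu> r = smult \<mu> ([:0, 1:] * p) - [:1, 0, -1:] * pderiv p"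
    using normalized_jacobi_Suc[OF n, of m] by (simp add: p_def r_def \<mu>_def)
  have r: "\<mu> * poly r u = \<mu> * u * poly p u - (1 - u\<^sup>2) * poly (pderiv p) u" for u
    using arg_cong[OF rec, of "\<lambda>q. poly q u"] by (simp add: algebra_simps power2_eq_square)
  \<comment> \<open>Differentiating the recursion produces p''; the equation for p removes it and
    leaves a formula of first order.\<close>
  have rec': "smult \<mu> (pderiv r) = smult (real m + 1) (smult \<mu> p + [:0, 1:] * pderiv p)"
  proof (rule poly_ext)
    fix u
    have "\<mu> * poly (pderiv r) u = \<mu> * (poly p u + u * poly (pderiv p) u)
        + 2 * u * poly (pderiv p) u - (1 - u\<^sup>2) * poly (pderiv (pderiv p)) u"
      using arg_cong[OF rec, of "\<lambda>q. poly (pderiv q) u"]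
      by (simp add: pderiv_smult pderiv_diff pderiv_mult pderiv_add pderiv_minus pderiv_pCons algebra_simps power2_eq_square)
    then show "poly (smult \<mu> (pderiv r)) u = poly (smult (real m + 1) (smult \<mu> p + [:0, 1:] * pderiv p)) u"
      unfolding IH by (simp add: \<mu>_def algebra_simps)
  qed
  have r': "\<mu> * poly (pderiv r) u = (real m + 1) * (\<mu> * poly p u + u * poly (pderiv p) u)"
    using arg_cong[OF rec', of "\<lambda>q. poly q u"] by simp
  have r'': "\<mu> * poly (pderiv (pderiv r)) u =
      (real m + 1) * ((\<mu> + 1) * poly (pderiv p) u + u * poly (pderiv (pderiv p)) u)"
    using arg_cong[OF rec', of "\<lambda>q. poly (pderiv q) u"]
    by (simp add: pderiv_smult pderiv_add pderiv_mult pderiv_pCons algebra_simps)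
  have "\<mu> * ((1 - u\<^sup>2) * poly (pderiv (pderiv r)) u) = (1 - u\<^sup>2) * (\<mu> * poly (pderiv (pderiv r)) u)"
    by simp
  also have "\<dots> = (real m + 1) * ((\<mu> + 1) * (1 - u\<^sup>2) * poly (pderiv p) u
      + u * ((1 - u\<^sup>2) * poly (pderiv (pderiv p)) u))"
    unfolding r'' by (simp add: algebra_simps)
  also have "\<dots> = (real n - 1) * u * (\<mu> * poly (pderiv r) u) - (real m + 1) * (\<mu> + 1) * (\<mu> * poly r u)"
    unfolding IH r r' by (simp add: \<mu>_def algebra_simps)
  finally have "\<mu> * ((1 - u\<^sup>2) * poly (pderiv (pderiv r)) u) =
      \<mu> * ((real n - 1) * u * poly (pderiv r) u - (real m + 1) * (\<mu> + 1) * poly r u)"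
    by (simp add: algebra_simps)
  moreover have "real (Suc m) = real m + 1" "real m + 1 + real n - 2 = \<mu> + 1"
    by (simp_all add: \<mu>_def)
  ultimately show ?case
    using \<mu> by (simp only: mult_cancel_left r_def) simp
qed

subsection \<open>Derivatives of polynomial functions along the sphere\<close>

text \<open>Derivatives along polynomial vector fields remain polynomial, which keeps the functions
  built in the induction for the kernels differentiable.\<close>

lemma real_polynomial_function_derivative:
  fixes p :: "'a::euclidean_space \<Rightarrow> real"
  assumes "real_polynomial_function p"
  obtains p' where "\<And>x. (p has_derivative p' x) (at x)"
    "\<And>v. polynomial_function v \<Longrightarrow> real_polynomial_function (\<lambda>x. p' x (v x))"
  using assms
proof (induction p arbitrary: thesis rule: real_polynomial_function.induct)
  case (linear p)
  then show ?case
    by (intro linear(2)[of "\<lambda>x. p"])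
      (auto simp: bounded_linear_imp_has_derivative polynomial_function_def o_def)
next
  case (const c)
  show ?case
    by (rule const[of "\<lambda>x v. 0"]) (auto intro: real_polynomial_function.intros)
next
  case (add p q)
  obtain p' where "\<And>x. (p has_derivative p' x) (at x)"
    "\<And>v. polynomial_function v \<Longrightarrow> real_polynomial_function (\<lambda>x. p' x (v x))"
    using add.IH(1) by blast
  moreover obtain q' where "\<And>x. (q has_derivative q' x) (at x)"
    "\<And>v. polynomial_function v \<Longrightarrow> real_polynomial_function (\<lambda>x. q' x (v x))"
    using add.IH(2) by blast
  ultimately show ?case
    by (intro add.prems[of "\<lambda>x v. p' x v + q' x v"])
      (auto intro!: derivative_intros real_polynomial_function.intros(3))
next
  case (mult p q)
  obtain p' where "\<And>x. (p has_derivative p' x) (at x)"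
    "\<And>v. polynomial_function v \<Longrightarrow> real_polynomial_function (\<lambda>x. p' x (v x))"
    using mult.IH(1) by blast
  moreover obtain q' where "\<And>x. (q has_derivative q' x) (at x)"
    "\<And>v. polynomial_function v \<Longrightarrow> real_polynomial_function (\<lambda>x. q' x (v x))"
    using mult.IH(2) by blast
  ultimately show ?case
    using mult.hyps
    by (intro mult.prems[of "\<lambda>x v. p x * q' x v + p' x v * q x"])
      (auto intro!: derivative_intros real_polynomial_function.intros(3,4))
qed

text \<open>Identities that hold only on the sphere may still be differentiated in tangential
  directions: both functions agree along the great circle through y with velocity w.\<close>

lemma tangential_derivative_unique:
  fixes g h :: "'a::real_inner \<Rightarrow> real"
  assumes g: "(g has_derivative g') (at y)" and h: "(h has_derivative h') (at y)"
    and eq: "\<And>z. norm z = 1 \<Longrightarrow> g z = h z" and y: "norm y = 1" and w: "y \<bullet> w = 0"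
  shows "g' w = h' w"
proof (cases "w = 0")
  case True
  then show ?thesis
    using g h by (simp add: has_derivative_def bounded_linear.linear linear_0)
next
  case False
  define r e where "r = norm w" and "e = w /\<^sub>R norm w"
  have w_eq: "w = r *\<^sub>R e" and e: "norm e = 1" "y \<bullet> e = 0"
    using False w by (auto simp: r_def e_def)
  define \<gamma> where "\<gamma> = (\<lambda>t. cos (r * t) *\<^sub>R y + sin (r * t) *\<^sub>R e)"
  have norm: "norm (\<gamma> t) = 1" for t
  proof -
    have "\<gamma> t \<bullet> \<gamma> t = (cos (r * t))\<^sup>2 * (y \<bullet> y) + (sin (r * t))\<^sup>2 * (e \<bullet> e)"
      using e(2) by (simp add: \<gamma>_def inner_simps inner_commute power2_eq_square)
    also have "\<dots> = 1"
      using y e by (simp add: dot_square_norm)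
    finally show ?thesis
      by (simp add: norm_eq_sqrt_inner)
  qed
  have \<gamma>': "(\<gamma> has_derivative (\<lambda>t. t *\<^sub>R w)) (at 0)"
    unfolding \<gamma>_def by (auto intro!: derivative_eq_intros simp: w_eq)
  have \<gamma>0: "\<gamma> 0 = y"
    by (simp add: \<gamma>_def)
  have "((\<lambda>t. g (\<gamma> t)) has_derivative (\<lambda>t. g' (t *\<^sub>R w))) (at 0)"
    using has_derivative_compose[OF \<gamma>', of g g'] g by (simp add: \<gamma>0)
  moreover have "((\<lambda>t. h (\<gamma> t)) has_derivative (\<lambda>t. h' (t *\<^sub>R w))) (at 0)"
    using has_derivative_compose[OF \<gamma>', of h h'] h by (simp add: \<gamma>0)
  ultimately have "(\<lambda>t. g' (t *\<^sub>R w)) = (\<lambda>t. h' (t *\<^sub>R w))"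
    using eq[OF norm] by (auto intro: has_derivative_unique)
  then show ?thesis
    by (auto dest: fun_cong[where x = 1])
qed

subsection \<open>Positive definiteness of zonal kernels\<close>

text \<open>Differentiating the kernel identity in x gives an identity that again holds for all unit
  vectors in the second argument, so it can be differentiated once more in y.\<close>

lemma zonal_kernel_derivatives:
  fixes \<phi> :: "'b \<Rightarrow> 'a::real_inner \<Rightarrow> real"
  assumes \<phi>': "\<And>j x. (\<phi> j has_derivative \<phi>' j x) (at x)"
    and kernel: "\<And>x y. norm x = 1 \<Longrightarrow> norm y = 1 \<Longrightarrow> (\<Sum>j\<in>J. \<phi> j x * \<phi> j y) = poly p (x \<bullet> y)"
    and x: "norm x = 1" and y: "norm y = 1" and v: "x \<bullet> v = 0"
  shows zonal_kernel_derivative_left: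
      "(\<Sum>j\<in>J. \<phi>' j x v * \<phi> j y) = poly (pderiv p) (x \<bullet> y) * (v \<bullet> y)"
    and zonal_kernel_derivative_mixed: "y \<bullet> w = 0 \<Longrightarrow> (\<Sum>j\<in>J. \<phi>' j x v * \<phi>' j y w) =
        poly (pderiv (pderiv p)) (x \<bullet> y) * (x \<bullet> w) * (v \<bullet> y) + poly (pderiv p) (x \<bullet> y) * (v \<bullet> w)"
proof -
  have poly': "((\<lambda>z. poly q (c z)) has_derivative (\<lambda>h. poly (pderiv q) (c z) * c' h)) (at z)"
    if "(c has_derivative c') (at z)" for q :: "real poly" and c c' and z :: 'a
    using has_derivative_compose[OF that, of "poly q" "(*) (poly (pderiv q) (c z))"] poly_DERIV[of q "c z"]
    by (simp add: has_field_derivative_def)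
  have left: "(\<Sum>j\<in>J. \<phi>' j x v * \<phi> j z) = poly (pderiv p) (x \<bullet> z) * (v \<bullet> z)" if "norm z = 1" for z
  proof (rule tangential_derivative_unique[where w = v and y = x])
    show "((\<lambda>t. \<Sum>j\<in>J. \<phi> j t * \<phi> j z) has_derivative (\<lambda>v. \<Sum>j\<in>J. \<phi>' j x v * \<phi> j z)) (at x)"
      by (auto intro!: derivative_eq_intros \<phi>')
    show "((\<lambda>t. poly p (t \<bullet> z)) has_derivative (\<lambda>v. poly (pderiv p) (x \<bullet> z) * (v \<bullet> z))) (at x)"
      by (rule poly') (auto intro!: derivative_eq_intros)
  qed (use kernel that x v in auto)
  show "(\<Sum>j\<in>J. \<phi>' j x v * \<phi> j y) = poly (pderiv p) (x \<bullet> y) * (v \<bullet> y)"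
    by (rule left) fact
  show "(\<Sum>j\<in>J. \<phi>' j x v * \<phi>' j y w) =
        poly (pderiv (pderiv p)) (x \<bullet> y) * (x \<bullet> w) * (v \<bullet> y) + poly (pderiv p) (x \<bullet> y) * (v \<bullet> w)"
    if w: "y \<bullet> w = 0"
  proof (rule tangential_derivative_unique[where w = w and y = y])
    show "((\<lambda>z. \<Sum>j\<in>J. \<phi>' j x v * \<phi> j z) has_derivative (\<lambda>w. \<Sum>j\<in>J. \<phi>' j x v * \<phi>' j y w)) (at y)"
      by (auto intro!: derivative_eq_intros \<phi>')
    have "((\<lambda>z. poly (pderiv p) (x \<bullet> z)) has_derivative
        (\<lambda>w. poly (pderiv (pderiv p)) (x \<bullet> y) * (x \<bullet> w))) (at y)"
      by (rule poly') (auto intro!: derivative_eq_intros)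
    then show "((\<lambda>z. poly (pderiv p) (x \<bullet> z) * (v \<bullet> z)) has_derivative
        (\<lambda>w. poly (pderiv (pderiv p)) (x \<bullet> y) * (x \<bullet> w) * (v \<bullet> y) + poly (pderiv p) (x \<bullet> y) * (v \<bullet> w))) (at y)"
      by (auto intro!: derivative_eq_intros)
  qed (use left w y in auto)
qed

lemma sum_lists_length_Suc:
  fixes g :: "'a::finite list \<Rightarrow> 'b::comm_monoid_add"
  shows "(\<Sum>l | length l = Suc m. g l) = (\<Sum>i\<in>UNIV. \<Sum>l | length l = m. g (i # l))"
proof -
  have "{l :: 'a list. length l = Suc m} = (\<lambda>(i, l). i # l) ` (UNIV \<times> {l. length l = m})"
    by (auto simp: length_Suc_conv image_iff)
  moreover have "inj_on (\<lambda>(i, l). i # l) (UNIV \<times> {l :: 'a list. length l = m})"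
    by (auto simp: inj_on_def)
  ultimately show ?thesis
    by (simp add: sum.reindex sum.cartesian_product case_prod_unfold)
qed

text \<open>The functions are indexed by words of length m, since each step of the induction adds
  one coordinate index. Degree 1 is done by hand: the step from 0 would multiply the constant by
  \<mu> = n - 2, which is 0 in the plane.\<close>

lemma normalized_jacobi_features:
  assumes n: "CARD('n) \<ge> 2"
  shows "\<exists>\<phi> :: 'n list \<Rightarrow> real ^ 'n \<Rightarrow> real. \<exists>C > 0. (\<forall>l. real_polynomial_function (\<phi> l)) \<and>
    (\<forall>x y. norm x = 1 \<longrightarrow> norm y = 1 \<longrightarrow>
      (\<Sum>l | length l = m. \<phi> l x * \<phi> l y) = C * poly (normalized_jacobi CARD('n) m) (x \<bullet> y))"
proof (cases "m = 0")
  case True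
  then show ?thesis
    by (intro exI[of _ "\<lambda>l x. 1"] exI[of _ 1])
      (auto simp: normalized_jacobi_0 intro: real_polynomial_function.intros(2))
next
  case False
  then have "1 \<le> m"
    by simp
  then show ?thesis
  proof (induction m rule: dec_induct)
    case base
    have "(\<Sum>l | length l = Suc 0. x $ hd l * y $ hd l) = x \<bullet> y" for x y :: "real ^ 'n"
      by (simp add: sum_lists_length_Suc inner_vec_def)
    then show ?case
      by (intro exI[of _ "\<lambda>l x. x $ hd l"] exI[of _ 1])
        (auto simp: normalized_jacobi_1[OF n] intro!: real_polynomial_function.intros(1) bounded_linear_vec_nth)
  next
    case (step m)
    define p :: "real poly" where "p = normalized_jacobi CARD('n) m"
    define n \<mu> where "n = real CARD('n)" and "\<mu> = real m + n - 2"
    obtain \<phi> :: "'n list \<Rightarrow> real ^ 'n \<Rightarrow> real" and C where C: "C > 0"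
      and \<phi>: "\<And>l. real_polynomial_function (\<phi> l)"
      and kernel: "\<And>x y. norm x = 1 \<Longrightarrow> norm y = 1 \<Longrightarrow>
        (\<Sum>l | length l = m. \<phi> l x * \<phi> l y) = poly (smult C p) (x \<bullet> y)"
      using step.IH unfolding p_def poly_smult by blast
    have "\<forall>l. \<exists>d. (\<forall>x. (\<phi> l has_derivative d x) (at x)) \<and>
        (\<forall>v. polynomial_function v \<longrightarrow> real_polynomial_function (\<lambda>x. d x (v x)))"
      using real_polynomial_function_derivative[OF \<phi>] by (intro allI) blast
    then obtain \<phi>' where \<phi>': "\<And>l x. (\<phi> l has_derivative \<phi>' l x) (at x)"
      "\<And>l v. polynomial_function v \<Longrightarrow> real_polynomial_function (\<lambda>x. \<phi>' l x (v x))"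
      by (auto dest!: choice)
    \<comment> \<open>For a unit vector x this is the projection of the i-th basis vector to the
      tangent space at x.\<close>
    define t :: "'n \<Rightarrow> real ^ 'n \<Rightarrow> real ^ 'n" where "t = (\<lambda>i x. axis i 1 - x $ i *\<^sub>R x)"
    have t: "x \<bullet> t i x = 0" if "norm x = 1" for x i
      using that by (simp add: t_def inner_simps inner_axis norm_eq_1)
    have poly_nth: "real_polynomial_function (\<lambda>x :: real ^ 'n. x $ i)" for i
      by (intro real_polynomial_function.intros(1) bounded_linear_vec_nth)
    have poly_t: "polynomial_function (t i)" for i
      unfolding t_def
      by (intro polynomial_function_diff polynomial_function_mult polynomial_function_const
          polynomial_function_id poly_nth[unfolded real_polynomial_function_eq])
    \<comment> \<open>For a harmonic form \<phi> of degree m, (2m + n - 2) times the harmonic part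
      of x_i \<phi> equals (2m + n - 2) x_i \<phi> minus the i-th partial derivative on the sphere.
      By Euler's relation that derivative is its tangential part plus m x_i \<phi>, which leaves the
      coefficient \<mu> = m + n - 2.\<close>
    define \<psi> where "\<psi> = (\<lambda>l x. \<mu> * x $ hd l * \<phi> (tl l) x - \<phi>' (tl l) x (t (hd l) x))"
    have \<psi>: "real_polynomial_function (\<psi> l)" for l
      unfolding \<psi>_def
      by (intro real_polynomial_function_diff real_polynomial_function.intros(2-4) poly_nth \<phi> \<phi>'(2) poly_t)
    have "(\<Sum>l | length l = Suc m. \<psi> l x * \<psi> l y) =
        C * (2 * real m + n - 2) * \<mu> * poly (normalized_jacobi CARD('n) (Suc m)) (x \<bullet> y)"
      if x: "norm x = 1" and y: "norm y = 1" for x y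
    proof -
      define u P P1 P2 where "u = x \<bullet> y" and "P = poly p u" and "P1 = poly (pderiv p) u"
        and "P2 = poly (pderiv (pderiv p)) u"
      have inner: "x \<bullet> t i y = x $ i - y $ i * u" "t i x \<bullet> y = y $ i - x $ i * u"
        "t i x \<bullet> t i y = 1 - (x $ i)\<^sup>2 - (y $ i)\<^sup>2 + x $ i * y $ i * u" for i
        by (simp_all add: t_def u_def inner_simps inner_axis inner_axis' power2_eq_square algebra_simps)
      have K: "(\<Sum>l | length l = m. \<phi> l x * \<phi> l y) = C * P"
        using kernel[OF x y] by (simp add: P_def u_def)
      have K1: "(\<Sum>l | length l = m. \<phi>' l z (t i z) * \<phi> l w) = C * poly (pderiv p) (z \<bullet> w) * (t i z \<bullet> w)"
        if "norm z = 1" "norm w = 1" for z w i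
      proof -
        have "(\<Sum>l | length l = m. \<phi>' l z (t i z) * \<phi> l w) = poly (pderiv (smult C p)) (z \<bullet> w) * (t i z \<bullet> w)"
          by (rule zonal_kernel_derivative_left[OF \<phi>'(1) kernel]) (use that t in auto)
        then show ?thesis
          by (simp add: pderiv_smult)
      qed
      have K2: "(\<Sum>l | length l = m. \<phi> l x * \<phi>' l y (t i y)) = C * P1 * (x \<bullet> t i y)" for i
        using K1[OF y x, of i] by (simp add: P1_def u_def inner_commute mult.commute)
      have K3: "(\<Sum>l | length l = m. \<phi>' l x (t i x) * \<phi>' l y (t i y)) =
          C * P2 * (x \<bullet> t i y) * (t i x \<bullet> y) + C * P1 * (t i x \<bullet> t i y)" for i
      proof -
        have "(\<Sum>l | length l = m. \<phi>' l x (t i x) * \<phi>' l y (t i y)) =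
            poly (pderiv (pderiv (smult C p))) (x \<bullet> y) * (x \<bullet> t i y) * (t i x \<bullet> y) +
            poly (pderiv (smult C p)) (x \<bullet> y) * (t i x \<bullet> t i y)"
          by (rule zonal_kernel_derivative_mixed[OF \<phi>'(1) kernel]) (use x y t in auto)
        then show ?thesis
          by (simp add: P1_def P2_def u_def pderiv_smult)
      qed
      have "(\<Sum>l | length l = m. \<psi> (i # l) x * \<psi> (i # l) y) =
          C * ((x $ i * y $ i) * (\<mu>\<^sup>2 * P + 2 * \<mu> * P1 * u + P2 * (1 + u\<^sup>2) + P1 * u)
            - ((x $ i)\<^sup>2 + (y $ i)\<^sup>2) * (\<mu> * P1 + P2 * u + P1) + P1)" for i
      proof -
        have "(\<Sum>l | length l = m. \<psi> (i # l) x * \<psi> (i # l) y) =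
            (\<Sum>l | length l = m. \<mu>\<^sup>2 * x $ i * y $ i * (\<phi> l x * \<phi> l y)
              - \<mu> * x $ i * (\<phi> l x * \<phi>' l y (t i y)) - \<mu> * y $ i * (\<phi>' l x (t i x) * \<phi> l y)
              + \<phi>' l x (t i x) * \<phi>' l y (t i y))"
          by (intro sum.cong) (auto simp: \<psi>_def algebra_simps power2_eq_square)
        also have "\<dots> = \<mu>\<^sup>2 * x $ i * y $ i * (C * P)
              - \<mu> * x $ i * (C * P1 * (x \<bullet> t i y)) - \<mu> * y $ i * (C * P1 * (t i x \<bullet> y))
              + (C * P2 * (x \<bullet> t i y) * (t i x \<bullet> y) + C * P1 * (t i x \<bullet> t i y))"
          unfolding sum.distrib sum_subtractf sum_distrib_left[symmetric] K K1[OF x y] K2 K3 P1_def u_def ..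
        finally show ?thesis
          unfolding inner by (simp add: algebra_simps power2_eq_square)
      qed
      moreover have "(\<Sum>i\<in>UNIV. x $ i * y $ i) = u" "(\<Sum>i\<in>UNIV. (x $ i)\<^sup>2) = 1" "(\<Sum>i\<in>UNIV. (y $ i)\<^sup>2) = 1"
        using x y by (simp_all add: u_def inner_vec_def norm_eq_1 power2_eq_square)
      ultimately have "(\<Sum>l | length l = Suc m. \<psi> l x * \<psi> l y) =
          C * (u * (\<mu>\<^sup>2 * P + 2 * \<mu> * P1 * u + P2 * (1 + u\<^sup>2) + P1 * u)
            - 2 * (\<mu> * P1 + P2 * u + P1) + n * P1)"
        unfolding sum_lists_length_Suc
        by (simp add: sum.distrib sum_subtractf n_def flip: sum_distrib_left sum_distrib_right)
      also have "\<dots> = C * (\<mu>\<^sup>2 * u * P - 2 * \<mu> * (1 - u\<^sup>2) * P1 - u * ((1 - u\<^sup>2) * P2) + (n - 2 + u\<^sup>2) * P1)"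
        by (simp add: algebra_simps power2_eq_square)
      also have "(1 - u\<^sup>2) * P2 = (n - 1) * u * P1 - real m * \<mu> * P"
        using normalized_jacobi_ode[OF assms(1) step.hyps(1), of u]
        by (simp add: P_def P1_def P2_def p_def n_def \<mu>_def)
      \<comment> \<open>The common factor 2m + n - 2 arises as \<mu> + m in the P terms and as
        2\<mu> - (n - 2) in the P1 terms.\<close>
      also have "C * (\<mu>\<^sup>2 * u * P - 2 * \<mu> * (1 - u\<^sup>2) * P1 - u * ((n - 1) * u * P1 - real m * \<mu> * P)
          + (n - 2 + u\<^sup>2) * P1) = C * (2 * real m + n - 2) * (\<mu> * u * P - (1 - u\<^sup>2) * P1)"
        by (simp add: \<mu>_def algebra_simps power2_eq_square)
      also have "\<mu> * u * P - (1 - u\<^sup>2) * P1 = \<mu> * poly (normalized_jacobi CARD('n) (Suc m)) u"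
        using arg_cong[OF normalized_jacobi_Suc[OF assms(1), of m], of "\<lambda>q. poly q u"]
        by (simp add: P_def P1_def p_def \<mu>_def n_def algebra_simps power2_eq_square)
      finally show ?thesis
        by (simp add: u_def)
    qed
    moreover have "C * (2 * real m + n - 2) * \<mu> > 0"
      using C assms(1) step.hyps by (simp add: \<mu>_def n_def)
    ultimately show ?case
      using \<psi> by (intro exI[of _ \<psi>] exI[of _ "C * (2 * real m + n - 2) * \<mu>"]) auto
  qed
qed

section \<open>Consequences of the kernel expansion\<close>

text \<open>Several caps may share an index; adding up c over each fibre of i gives the vector to
  which the matrix is applied.\<close>

lemma pos_semidef_pullback_nonneg:
  assumes M: "pos_semidef N M" and K: "finite K" and i: "\<And>k. k \<in> K \<Longrightarrow> i k \<in> {1..N}"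
  shows "(\<Sum>k\<in>K. \<Sum>l\<in>K. c k * M (i k) (i l) * c l) \<ge> 0"
proof -
  define d where "d = (\<lambda>a. \<Sum>k | k \<in> K \<and> i k = a. c k)"
  have group: "(\<Sum>a=1..N. g a * d a) = (\<Sum>k\<in>K. g (i k) * c k)" for g :: "nat \<Rightarrow> real"
  proof -
    have "(\<Sum>a=1..N. g a * d a) = (\<Sum>a=1..N. \<Sum>k | k \<in> K \<and> i k = a. g (i k) * c k)"
      unfolding d_def sum_distrib_left by (intro sum.cong) auto
    also have "\<dots> = (\<Sum>k\<in>K. g (i k) * c k)"
      using K i by (intro sum.group) auto
    finally show ?thesis .
  qed
  have "(\<Sum>a=1..N. \<Sum>b=1..N. d a * M a b * d b) = (\<Sum>a=1..N. (\<Sum>b=1..N. M a b * d b) * d a)"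
    unfolding sum_distrib_right by (intro sum.cong refl) (simp only: mult_ac)
  also have "\<dots> = (\<Sum>k\<in>K. (\<Sum>l\<in>K. M (i k) (i l) * c l) * c k)"
    by (simp only: group)
  also have "\<dots> = (\<Sum>k\<in>K. \<Sum>l\<in>K. c k * M (i k) (i l) * c l)"
    unfolding sum_distrib_right by (intro sum.cong refl) (simp only: mult_ac)
  finally show ?thesis
    using M unfolding pos_semidef_def by metis
qed

text \<open>A Schur product argument: expanding the kernel writes the sum, up to C > 0, as a sum
  over words q of quadratic forms in the vectors c k * \<phi> q (x k).\<close>

lemma pos_semidef_normalized_jacobi_nonneg:
  fixes x :: "'b \<Rightarrow> real ^ 'n"
  assumes n: "CARD('n) \<ge> 2" and M: "pos_semidef N M"
    and K: "finite K" "\<And>k. k \<in> K \<Longrightarrow> i k \<in> {1..N}" "\<And>k. k \<in> K \<Longrightarrow> norm (x k) = 1"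
  shows "(\<Sum>k\<in>K. \<Sum>l\<in>K. c k * c l * (M (i k) (i l) *
    poly (normalized_jacobi CARD('n) m) (x k \<bullet> x l))) \<ge> 0" (is "?S \<ge> 0")
proof -
  obtain \<phi> :: "'n list \<Rightarrow> real ^ 'n \<Rightarrow> real" and C where C: "C > 0"
    and kernel: "\<And>x y. norm x = 1 \<Longrightarrow> norm y = 1 \<Longrightarrow>
      (\<Sum>l | length l = m. \<phi> l x * \<phi> l y) = C * poly (normalized_jacobi CARD('n) m) (x \<bullet> y)"
    using normalized_jacobi_features[OF n, of m] by blast
  have "C * ?S = (\<Sum>k\<in>K. \<Sum>l\<in>K. c k * c l * (M (i k) (i l) * (\<Sum>q | length q = m. \<phi> q (x k) * \<phi> q (x l))))"
    unfolding sum_distrib_left[where r = C] using kernel K(3) by (intro sum.cong) auto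
  also have "\<dots> = (\<Sum>k\<in>K. \<Sum>l\<in>K. \<Sum>q | length q = m. (c k * \<phi> q (x k)) * M (i k) (i l) * (c l * \<phi> q (x l)))"
    unfolding sum_distrib_left by (intro sum.cong refl) (simp only: mult_ac)
  also have "\<dots> = (\<Sum>k\<in>K. \<Sum>q | length q = m. \<Sum>l\<in>K. (c k * \<phi> q (x k)) * M (i k) (i l) * (c l * \<phi> q (x l)))"
    by (intro sum.cong refl sum.swap)
  also have "\<dots> = (\<Sum>q | length q = m. \<Sum>k\<in>K. \<Sum>l\<in>K.
      (c k * \<phi> q (x k)) * M (i k) (i l) * (c l * \<phi> q (x l)))"
    by (rule sum.swap)
  also have "\<dots> \<ge> 0"
    using M K(1,2) by (intro sum_nonneg pos_semidef_pullback_nonneg)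
  finally show ?thesis
    using C by (simp add: zero_le_mult_iff)
qed

text \<open>This is Cauchy-Schwarz for the vectors (\<phi> l x) and (\<phi> l y), both of squared
  norm C. It makes the series for \<open>F\<close> converge on the sphere.\<close>

lemma abs_normalized_jacobi_inner_le_1:
  fixes x y :: "real ^ 'n"
  assumes n: "CARD('n) \<ge> 2" and xy: "norm x = 1" "norm y = 1"
  shows "\<bar>poly (normalized_jacobi CARD('n) m) (x \<bullet> y)\<bar> \<le> 1"
proof -
  define p where "p = poly (normalized_jacobi CARD('n) m)"
  obtain \<phi> :: "'n list \<Rightarrow> real ^ 'n \<Rightarrow> real" and C where C: "C > 0"
    and kernel: "\<And>x y. norm x = 1 \<Longrightarrow> norm y = 1 \<Longrightarrow>
      (\<Sum>l | length l = m. \<phi> l x * \<phi> l y) = C * p (x \<bullet> y)"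
    using normalized_jacobi_features[OF n, of m] unfolding p_def by blast
  have 1: "x \<bullet> x = 1" "y \<bullet> y = 1" "p 1 = 1"
    using xy n by (simp_all add: norm_eq_1 p_def poly_normalized_jacobi_1)
  have minus: "(\<Sum>l | length l = m. (\<phi> l x - \<phi> l y)\<^sup>2) = C * (2 - 2 * p (x \<bullet> y))"
    using kernel[OF xy(1,1)] kernel[OF xy(2,2)] kernel[OF xy] kernel[OF xy(2,1)]
    by (simp add: power2_eq_square algebra_simps sum.distrib sum_subtractf inner_commute 1 flip: sum_distrib_left)
  have plus: "(\<Sum>l | length l = m. (\<phi> l x + \<phi> l y)\<^sup>2) = C * (2 + 2 * p (x \<bullet> y))"
    using kernel[OF xy(1,1)] kernel[OF xy(2,2)] kernel[OF xy] kernel[OF xy(2,1)]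
    by (simp add: power2_eq_square algebra_simps sum.distrib inner_commute 1 flip: sum_distrib_left)
  have "C * (2 - 2 * p (x \<bullet> y)) \<ge> 0" "C * (2 + 2 * p (x \<bullet> y)) \<ge> 0"
    unfolding minus[symmetric] plus[symmetric] by (intro sum_nonneg zero_le_power2)+
  then show ?thesis
    using C by (simp add: p_def zero_le_mult_iff abs_le_iff)
qed

subsection \<open>The linear programming bound\<close>

lemma orthogonal_decomposition_arccos:
  fixes x y :: "real ^ 'n"
  assumes "CARD('n) \<ge> 2" and x: "norm x = 1" and y: "norm y = 1"
  obtains e where "norm e = 1" "x \<bullet> e = 0"
    "y = cos (arccos (x \<bullet> y)) *\<^sub>R x + sin (arccos (x \<bullet> y)) *\<^sub>R e"
proof -
  have u: "\<bar>x \<bullet> y\<bar> \<le> 1"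
    using Cauchy_Schwarz_ineq2[of x y] x y by simp
  then have cs: "cos (arccos (x \<bullet> y)) = x \<bullet> y" "sin (arccos (x \<bullet> y)) = sqrt (1 - (x \<bullet> y)\<^sup>2)"
    by (auto simp: cos_arccos_abs sin_arccos_abs)
  define z where "z = y - (x \<bullet> y) *\<^sub>R x"
  have xz: "x \<bullet> z = 0"
    using x by (simp add: z_def inner_simps dot_square_norm)
  have "z \<bullet> z = 1 - (x \<bullet> y)\<^sup>2"
    using x y by (simp add: z_def inner_simps norm_eq_1 inner_commute power2_eq_square)
  then have nz: "norm z = sqrt (1 - (x \<bullet> y)\<^sup>2)"
    by (simp add: norm_eq_sqrt_inner)
  show ?thesis
  proof (cases "z = 0")
    \<comment> \<open>Here y is x or -x and the sine vanishes, so any unit vector orthogonal to x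
      serves; one exists in dimension at least 2.\<close>
    case True
    have "2 \<le> DIM(real ^ 'n)"
      using assms(1) by simp
    then obtain b where b: "b \<noteq> 0" "orthogonal x b"
      using orthogonal_to_vector_exists by blast
    show ?thesis
      using that[of "b /\<^sub>R norm b"] b True nz cs by (simp add: orthogonal_def z_def)
  next
    case False
    have "y = (x \<bullet> y) *\<^sub>R x + norm z *\<^sub>R (z /\<^sub>R norm z)"
      using False by (simp add: z_def)
    then show ?thesis
      using that[of "z /\<^sub>R norm z"] norm_sgn[of z] False xz
      unfolding cs nz[symmetric] by (simp add: sgn_div_norm)
  qed
qed

text \<open>If the angle \<theta> between the centers were below a + b, some point of the arc
  joining them would be interior to both caps. Hence a + b \<le> \<theta> \<le> pi, a range on which
  the cosine decreases.\<close>

lemma disjoint_caps_inner_le: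
  fixes x y :: "real ^ 'n"
  assumes n: "CARD('n) \<ge> 2" and x: "norm x = 1" and y: "norm y = 1"
    and a: "a \<in> {0<..pi}" and b: "b \<in> {0<..pi}"
    and disj: "disjnt (top_of_set (sphere 0 1) interior_of cap x a)
              (top_of_set (sphere 0 1) interior_of cap y b)"
  shows "x \<bullet> y \<le> cos (a + b)"
proof -
  define \<theta> where "\<theta> = arccos (x \<bullet> y)"
  have u: "\<bar>x \<bullet> y\<bar> \<le> 1"
    using Cauchy_Schwarz_ineq2[of x y] x y by simp
  then have \<theta>: "0 \<le> \<theta>" "\<theta> \<le> pi" "cos \<theta> = x \<bullet> y"
    using arccos_lbound arccos_ubound by (auto simp: \<theta>_def abs_le_iff cos_arccos_abs)
  have interior: "z \<in> top_of_set (sphere 0 1) interior_of cap c t"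
    if "norm z = 1" "c \<bullet> z > cos t" for z c :: "real ^ 'n" and t
  proof -
    have "openin (top_of_set (sphere 0 1)) (sphere 0 1 \<inter> {z. c \<bullet> z > cos t})"
      by (intro openin_open_Int open_halfspace_gt)
    then show ?thesis
      using that unfolding interior_of_def
      by (intro CollectI exI[of _ "sphere 0 1 \<inter> {z. c \<bullet> z > cos t}"]) (auto simp: cap_def)
  qed
  have "a + b \<le> \<theta>"
  proof (rule ccontr)
    assume "\<not> a + b \<le> \<theta>"
    \<comment> \<open>Dividing the arc in the ratio a : b gives s < a and \<theta> - s < b at
      once.\<close>
    define s where "s = \<theta> * a / (a + b)"
    have "\<theta> * a < (a + b) * a" "\<theta> * b < (a + b) * b"
      using a b \<open>\<not> a + b \<le> \<theta>\<close> by (simp_all add: mult_strict_right_mono)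
    then have s: "0 \<le> s" "s < a" "0 \<le> \<theta> - s" "\<theta> - s < b"
      using a b \<theta>(1) by (auto simp: s_def field_simps)
    obtain e where e: "norm e = 1" "x \<bullet> e = 0" "y = cos \<theta> *\<^sub>R x + sin \<theta> *\<^sub>R e"
      using orthogonal_decomposition_arccos[OF n x y] unfolding \<theta>_def by blast
    define z where "z = cos s *\<^sub>R x + sin s *\<^sub>R e"
    have "z \<bullet> z = (cos s)\<^sup>2 * (x \<bullet> x) + (sin s)\<^sup>2 * (e \<bullet> e)"
      using e(2) by (simp add: z_def inner_simps inner_commute power2_eq_square)
    also have "\<dots> = 1"
      using x e(1) by (simp add: dot_square_norm)
    finally have "norm z = 1"
      by (simp add: norm_eq_sqrt_inner)
    moreover have "x \<bullet> z = cos s"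
      using x e by (simp add: z_def inner_simps dot_square_norm)
    moreover have "cos s > cos a"
      using s a by (intro cos_monotone_0_pi) auto
    moreover have "y \<bullet> z = cos (\<theta> - s)"
      using x e(1,2) by (subst e(3)) (simp add: z_def inner_simps dot_square_norm inner_commute cos_diff)
    moreover have "cos (\<theta> - s) > cos b"
      using s b by (intro cos_monotone_0_pi) auto
    ultimately show False
      using disj interior[of z a x] interior[of z b y] by (auto simp: disjnt_iff)
  qed
  then show ?thesis
    using a b \<theta> cos_monotone_0_pi_le[of "a + b" \<theta>] by auto
qed

lemma cap_volume_nonneg:
  assumes "n \<ge> 2"
  shows "cap_volume n \<alpha> \<ge> 0"
proof -
  have "sphere_area k \<ge> 0" if "k \<ge> 1" for k
    using that by (simp add: sphere_area_def less_imp_le)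
  \<comment> \<open>A nonexistent integral has the value 0, so the claim holds in either
    case.\<close>
  moreover have "integral {cos \<alpha>..1} (\<lambda>u. (1 - u\<^sup>2) powr ((real n - 3) / 2)) \<ge> 0"
    by (cases "(\<lambda>u. (1 - u\<^sup>2) powr ((real n - 3) / 2)) integrable_on {cos \<alpha>..1}")
      (auto intro: integral_nonneg simp: not_integrable_integral)
  ultimately show ?thesis
    using assms by (simp add: cap_volume_def)
qed

theorem theorem1p2:
  fixes N :: nat and \<alpha> :: "nat \<Rightarrow> real" and f :: "nat \<Rightarrow> nat \<Rightarrow> nat \<Rightarrow> real"
    and P :: "((real ^ 'n) \<times> real) set"
  defines "F \<equiv> \<lambda>i j u. \<Sum>k. f i j k * poly (normalized_jacobi CARD('n) k) u"
  assumes "CARD('n) \<ge> 2" and "N \<ge> 1"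
    and "\<And>i. i \<in> {1..N} \<Longrightarrow> \<alpha> i \<in> {0<..pi}"
    and "\<And>i j k. i \<in> {1..N} \<Longrightarrow> j \<in> {1..N} \<Longrightarrow> f i j k = f j i k"
    and "\<And>i j. i \<in> {1..N} \<Longrightarrow> j \<in> {1..N} \<Longrightarrow> summable (\<lambda>k. \<bar>f i j k\<bar>)"
    and "pos_semidef N (\<lambda>i j. f i j 0 -
           sqrt (cap_volume CARD('n) (\<alpha> i)) * sqrt (cap_volume CARD('n) (\<alpha> j)))"
    and "\<And>k. k \<ge> 1 \<Longrightarrow> pos_semidef N (\<lambda>i j. f i j k)"
    and "\<And>i j u. i \<in> {1..N} \<Longrightarrow> j \<in> {1..N} \<Longrightarrow> -1 \<le> u \<Longrightarrow> u \<le> cos (\<alpha> i + \<alpha> j) \<Longrightarrow> F i j u \<le> 0"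
    and "cap_packing (\<alpha> ` {1..N}) P"
  shows "packing_density P \<le> ereal (Max ((\<lambda>i. F i i 1) ` {1..N}))"
proof -
  note n = \<open>CARD('n) \<ge> 2\<close> and \<alpha> = assms(4) and summ = assms(6) and psd0 = assms(7)
    and psd = assms(8) and F_le_0 = assms(9) and pack = \<open>cap_packing _ P\<close>
  define p where "p = (\<lambda>m. poly (normalized_jacobi CARD('n) m))"
  define w where "w = cap_volume CARD('n)"
  define B where "B = Max ((\<lambda>i. F i i 1) ` {1..N})"
  have w: "w a \<ge> 0" for a
    unfolding w_def by (rule cap_volume_nonneg[OF n])
  have F_le_B: "F i i 1 \<le> B" if "i \<in> {1..N}" for i
    unfolding B_def using that by (intro Max_ge) auto
  have p1: "p m 1 = 1" for m
    by (simp add: p_def poly_normalized_jacobi_1 n)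
  have p0: "p 0 u = 1" for u
    by (simp add: p_def normalized_jacobi_0)
  have F_sums: "(\<lambda>m. f i j m * p m (x \<bullet> y)) sums F i j (x \<bullet> y)"
    if "i \<in> {1..N}" "j \<in> {1..N}" "norm x = 1" "norm y = 1" for i j and x y :: "real ^ 'n"
    unfolding F_def p_def
  proof (intro summable_sums summable_comparison_test'[OF summ[OF that(1,2)]])
    fix m
    show "norm (f i j m * poly (normalized_jacobi CARD('n) m) (x \<bullet> y)) \<le> \<bar>f i j m\<bar>"
      using abs_normalized_jacobi_inner_le_1[OF n that(3,4), of m]
      by (simp add: abs_mult mult_left_le)
  qed
  have diag: "c * M i i * c \<ge> 0" if "pos_semidef N M" "i \<in> {1..N}" for M i and c :: real
    using pos_semidef_pullback_nonneg[OF that(1), of "{()}" "\<lambda>_. i" "\<lambda>_. c"] that(2) by simp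
  \<comment> \<open>This leads to B \<ge> 0, which settles the case D = 0 at the end, where D cannot
    be cancelled from D * D \<le> D * B.\<close>
  have "f 1 1 m \<ge> 0" for m
  proof (cases m)
    case 0
    have "f 1 1 0 - w (\<alpha> 1) \<ge> 0"
      using diag[OF psd0, of 1 1] \<open>N \<ge> 1\<close> w by (simp flip: w_def)
    then show ?thesis
      using w[of "\<alpha> 1"] 0 by simp
  next
    case (Suc _)
    then show ?thesis
      using diag[OF psd, of m 1 1] \<open>N \<ge> 1\<close> by simp
  qed
  then have "F 1 1 1 \<ge> 0"
    unfolding F_def using summ[of 1 1] \<open>N \<ge> 1\<close> p1 unfolding p_def by (intro suminf_nonneg) auto
  then have B: "B \<ge> 0"
    using F_le_B[of 1] \<open>N \<ge> 1\<close> by auto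

  \<comment> \<open>A packing records angles, not indices. Different indices may have the same
    angle, so one index is chosen for each.\<close>
  define idx where "idx = inv_into {1..N} \<alpha>"
  have finite_bound: "(\<Sum>q\<in>Q. w (snd q)) \<le> B" if Q: "finite Q" "Q \<subseteq> P" for Q
  proof -
    \<comment> \<open>With the weights s, the rank one part of the matrix in (i) contributes exactly
      D * D.\<close>
    define D s i where "D = (\<Sum>q\<in>Q. w (snd q))" and "s = (\<lambda>q :: (real ^ 'n) \<times> real. sqrt (w (snd q)))"
      and "i = (\<lambda>q :: (real ^ 'n) \<times> real. idx (snd q))"
    have sphere: "norm (fst q) = 1" and snd: "snd q \<in> \<alpha> ` {1..N}" if "q \<in> Q" for q
      using that Q pack by (auto simp: cap_packing_def)
    have i: "i q \<in> {1..N}" and \<alpha>_i: "\<alpha> (i q) = snd q" if "q \<in> Q" for q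
      using snd[OF that] by (simp_all add: i_def idx_def inv_into_into f_inv_into_f del: atLeastAtMost_iff)
    have s2: "s q * s q = w (snd q)" for q
      using w by (simp add: s_def)
    define T where "T = (\<lambda>m. \<Sum>k\<in>Q. \<Sum>l\<in>Q. s k * s l * (f (i k) (i l) m * p m (fst k \<bullet> fst l)))"
    have T_sums: "T sums (\<Sum>k\<in>Q. \<Sum>l\<in>Q. s k * s l * F (i k) (i l) (fst k \<bullet> fst l))"
      unfolding T_def by (intro sums_sum sums_mult F_sums i sphere)
    have "T m \<ge> 0" if "m \<ge> 1" for m
      unfolding T_def p_def
      using pos_semidef_normalized_jacobi_nonneg[OF n psd[OF that] Q(1) i sphere] .
    then have "T 0 \<le> suminf T"
      using sum_le_suminf[of T "{0}"] sums_summable[OF T_sums] by (simp add: Suc_le_eq)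
    \<comment> \<open>Hypothesis (i) is applied with degree 0; the factor 1 is the constant
      polynomial of that degree.\<close>
    have "0 \<le> (\<Sum>k\<in>Q. \<Sum>l\<in>Q. s k * s l * ((f (i k) (i l) 0 - sqrt (w (\<alpha> (i k))) * sqrt (w (\<alpha> (i l)))) * 1))"
      using pos_semidef_normalized_jacobi_nonneg[OF n psd0 Q(1) i sphere, where c = s and m = 0]
      by (simp add: normalized_jacobi_0 flip: w_def)
    also have "\<dots> = T 0 - (\<Sum>k\<in>Q. \<Sum>l\<in>Q. (s k * s k) * (s l * s l))"
      unfolding T_def sum_subtractf[symmetric] using \<alpha>_i
      by (intro sum.cong refl) (simp add: p0 s_def algebra_simps)
    also have "(\<Sum>k\<in>Q. \<Sum>l\<in>Q. (s k * s k) * (s l * s l)) = D * D"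
      unfolding s2 D_def sum_product ..
    finally have "D * D \<le> T 0"
      by simp
    also have "T 0 \<le> suminf T" by fact
    also have "\<dots> = (\<Sum>k\<in>Q. \<Sum>l\<in>Q. s k * s l * F (i k) (i l) (fst k \<bullet> fst l))"
      using T_sums by (rule sums_unique[symmetric])
    \<comment> \<open>Disjointness of the caps and (iii) make the terms off the diagonal
      nonpositive; on the diagonal the argument of \<open>F\<close> is 1.\<close>
    also have "\<dots> \<le> (\<Sum>k\<in>Q. \<Sum>l\<in>Q. if k = l then w (snd k) * B else 0)"
    proof (intro sum_mono)
      fix k l assume kl: "k \<in> Q" "l \<in> Q"
      show "s k * s l * F (i k) (i l) (fst k \<bullet> fst l) \<le> (if k = l then w (snd k) * B else 0)"
      proof (cases "k = l")
        case True
        have "fst k \<bullet> fst k = 1"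
          using sphere[OF kl(1)] by (simp add: norm_eq_1)
        then show ?thesis
          using F_le_B[OF i[OF kl(1)]] w True s2[of k] by (simp add: mult_left_mono)
      next
        case False
        have "pairwise (\<lambda>(x, a) (y, b). disjnt (top_of_set (sphere 0 1) interior_of cap x a)
              (top_of_set (sphere 0 1) interior_of cap y b)) P"
          using pack by (simp add: cap_packing_def)
        from pairwiseD[OF this _ _ False]
        have "disjnt (top_of_set (sphere 0 1) interior_of cap (fst k) (snd k))
              (top_of_set (sphere 0 1) interior_of cap (fst l) (snd l))"
          using kl Q by (auto simp: case_prod_unfold)
        then have "fst k \<bullet> fst l \<le> cos (\<alpha> (i k) + \<alpha> (i l))"
          using kl by (intro disjoint_caps_inner_le n sphere \<alpha> i) (simp_all add: \<alpha>_i)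
        moreover have "-1 \<le> fst k \<bullet> fst l"
          using Cauchy_Schwarz_ineq2[of "fst k" "fst l"] sphere[OF kl(1)] sphere[OF kl(2)] by simp
        ultimately have "F (i k) (i l) (fst k \<bullet> fst l) \<le> 0"
          using kl by (intro F_le_0 i)
        then show ?thesis
          using False w by (simp add: s_def mult_nonneg_nonpos)
      qed
    qed
    also have "\<dots> = D * B"
      using Q(1) by (simp add: D_def sum_distrib_right)
    finally have "D * D \<le> D * B" .
    moreover have "D \<ge> 0"
      unfolding D_def by (intro sum_nonneg w)
    ultimately show ?thesis
      using B unfolding D_def[symmetric] by (cases "D = 0") (auto simp: mult_le_cancel_left)
  qed
  \<comment> \<open>The density is the supremum over finite subpackings, so their uniform bound also
    covers infinite P.\<close>
  have "packing_density P = (SUP Q\<in>{Q. finite Q \<and> Q \<subseteq> P}. \<Sum>(x, a)\<in>Q. ereal (w a))"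
    unfolding packing_density_def w_def[symmetric]
    by (rule nonneg_infsum_complete) (auto simp: w)
  also have "\<dots> \<le> ereal B"
    using finite_bound by (intro SUP_least) (auto simp: case_prod_unfold)
  finally show ?thesis
    by (simp add: B_def)
qed

end
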